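(* Let $r\ge 1$ be an integer, $k_1,\dots,k_r$ integers, and $a,b,c$ positive real numbers. Then for every integer $n\ge 0$, $$E^{(k_1,\dots,k_r)}_n(x;a,b,c)=\sum_{m=0}^{\infty}\sum_{l=m}^{n}(r\ln c)^l\left\{ l \atop m\right\}\binom{n}{l}E^{(k_1,\dots,k_r)}_{n-l}(0;a,b)\,(x)_m.$$
   Context: The multiple polylogarithm is the formal power series $\mathrm{Li}_{(k_1,\dots,k_r)}(z)=\sum_{0<m_1<m_2<\dots<m_r}\frac{z^{m_r}}{m_1^{k_1}m_2^{k_2}\cdots m_r^{k_r}}$. For $u>0$ write $u^{t}=e^{t\ln u}$. The generalized multi poly-Euler polynomials $E^{(k_1,\dots,k_r)}_n(x;a,b,c)$ are defined by $$\frac{2\,\mathrm{Li}_{(k_1,\dots,k_r)}(1-(ab)^{-t})}{(a^{-t}+b^{t})^r}\,c^{rxt}=\sum_{n=0}^{\infty}E^{(k_1,\dots,k_r)}_n(x;a,b,c)\frac{t^n}{n!},$$ and $E^{(k_1,\dots,k_r)}_n(x;a,b):=E^{(k_1,\dots,k_r)}_n(x;a,b,e)$. $\left\{ l \atop m\right\}$ denotes the Stirling numbers of the second kind, and $(x)_m=x(x-1)\cdots(x-m+1)$ is the falling factorial, $(x)_0=1$. *)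

theory Defs
  imports
    Complex_Main
    "HOL-Computational_Algebra.Formal_Power_Series"
    "HOL-Combinatorics.Stirling"
begin

text \<open>
  Power series are formal series in \<open>t\<close> over a normed field extension of the reals, such
  as \<^typ>\<open>real\<close> or \<^typ>\<open>complex\<close>, in which the argument \<open>x\<close> of the polynomials lives.
\<close>

definition increasing_indices :: "nat \<Rightarrow> nat \<Rightarrow> nat list set" where
  "increasing_indices r n =
     {ms. length ms = r \<and> sorted_wrt (<) ms \<and> (\<forall>m\<in>set ms. 0 < m) \<and> last ms = n}"

text \<open>
  Only used for \<open>r \<ge> 1\<close>, since \<^term>\<open>last []\<close> is unspecified. The sets are then finite, so
  that the finite sum in the definition of the multiple polylogarithm below collects all
  terms with \<open>m\<^sub>r = n\<close>.
\<close>

lemma finite_increasing_indices: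
  assumes "r \<ge> 1"
  shows "finite (increasing_indices r n)"
proof (rule finite_subset)
  show "increasing_indices r n \<subseteq> {ms. set ms \<subseteq> {..n} \<and> length ms = r}"
  proof
    fix ms assume "ms \<in> increasing_indices r n"
    then have ms: "length ms = r" "sorted_wrt (<) ms" "last ms = n"
      by (auto simp: increasing_indices_def)
    with assms have "ms \<noteq> []" by auto
    then obtain xs where "ms = xs @ [n]"
      using ms(3) by (metis append_butlast_last_id)
    with ms show "ms \<in> {ms. set ms \<subseteq> {..n} \<and> length ms = r}"
      by (auto simp: sorted_wrt_append less_imp_le)
  qed
qed (simp add: finite_lists_length_eq)

definition multi_polylog :: "int list \<Rightarrow> 'a::real_normed_field fps" where
  "multi_polylog ks = Abs_fps (\<lambda>n.
     \<Sum>ms\<in>increasing_indices (length ks) n. 1 / (\<Prod>i<length ks. of_nat (ms ! i) powi (ks ! i)))"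

text \<open>\<open>fps_rpow u s\<close> is the formal power series of \<open>u\<^bsup>st\<^esup> = exp (s t ln u)\<close> in \<open>t\<close>.\<close>

definition fps_rpow :: "real \<Rightarrow> 'a \<Rightarrow> 'a::real_normed_field fps" where
  "fps_rpow u s = fps_exp (s * of_real (ln u))"

definition multi_poly_euler_gf ::
    "int list \<Rightarrow> 'a \<Rightarrow> real \<Rightarrow> real \<Rightarrow> real \<Rightarrow> 'a::real_normed_field fps" where
  "multi_poly_euler_gf ks x a b c =
     2 * fps_compose (multi_polylog ks) (1 - fps_rpow (a * b) (-1))
       / (fps_rpow a (-1) + fps_rpow b 1) ^ length ks
       * fps_rpow c (of_nat (length ks) * x)"

definition multi_poly_euler ::
    "int list \<Rightarrow> nat \<Rightarrow> 'a \<Rightarrow> real \<Rightarrow> real \<Rightarrow> real \<Rightarrow> 'a::real_normed_field" where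
  "multi_poly_euler ks n x a b c = fact n * fps_nth (multi_poly_euler_gf ks x a b c) n"

lemma multi_poly_euler_generating_function:
  "multi_poly_euler_gf ks x a b c = Abs_fps (\<lambda>n. multi_poly_euler ks n x a b c / fact n)"
  by (simp add: fps_eq_iff multi_poly_euler_def)

abbreviation multi_poly_euler_e ::
    "int list \<Rightarrow> nat \<Rightarrow> 'a \<Rightarrow> real \<Rightarrow> real \<Rightarrow> 'a::real_normed_field" where
  "multi_poly_euler_e ks n x a b \<equiv> multi_poly_euler ks n x a b (exp 1)"

definition falling_factorial :: "'a::comm_ring_1 \<Rightarrow> nat \<Rightarrow> 'a" where
  "falling_factorial x m = (\<Prod>i<m. x - of_nat i)"

end

theory Submission
  imports Defs
begin

text \<open>The variable \<open>x\<close> enters the generating function only through the factor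
  c^(rxt) = exp(r x ln(c) t), so the series for \<open>x\<close> and \<open>c\<close> is the series
  at 0 times an exponential (\<open>multi_poly_euler_gf_eq_mult_exp\<close>). Comparing coefficients
  gives a binomial expansion in powers of r ln(c) x (\<open>multi_poly_euler_expansion\<close>).
  Converting each x^l to falling factorials by Stirling numbers and exchanging the sums over the
  triangle m \<le> l \<le> n gives the formula; the series over \<open>m\<close> is in fact
  finite.\<close>

text \<open>Induction on \<open>l\<close>: the rule x (x)_m = (x)_(m+1) + m (x)_m mirrors the
  Stirling recurrence.\<close>

lemma power_eq_sum_Stirling_falling_factorial:
  fixes x :: "'a::comm_ring_1"
  shows "x ^ l = (\<Sum>m\<le>l. of_nat (Stirling l m) * falling_factorial x m)"
proof (induction l)
  case 0
  show ?case by (simp add: falling_factorial_def)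
next
  case (Suc l)
  let ?f = "falling_factorial x"
  have step: "x * ?f m = ?f (Suc m) + of_nat m * ?f m" for m
    by (simp add: falling_factorial_def algebra_simps)
  \<comment> \<open>The term m = 0 drops out because \<open>Stirling (Suc l) 0 = 0\<close>.\<close>
  have "(\<Sum>m\<le>Suc l. of_nat (Stirling (Suc l) m) * ?f m)
      = (\<Sum>m\<le>l. of_nat (Stirling (Suc l) (Suc m)) * ?f (Suc m))"
    by (subst sum.atMost_Suc_shift) simp
  also have "\<dots> = (\<Sum>m\<le>l. of_nat (Stirling l m) * ?f (Suc m))
      + (\<Sum>m\<le>l. of_nat (Suc m * Stirling l (Suc m)) * ?f (Suc m))"
    by (simp add: algebra_simps sum.distrib)
  \<comment> \<open>Shifting the index back adds only a term m = 0, which the factor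
    \<open>m\<close> kills; the top term then vanishes because
    \<open>Stirling l (Suc l) = 0\<close>.\<close>
  also have "(\<Sum>m\<le>l. of_nat (Suc m * Stirling l (Suc m)) * ?f (Suc m))
      = (\<Sum>m\<le>Suc l. of_nat (m * Stirling l m) * ?f m)"
    by (subst sum.atMost_Suc_shift) simp
  also have "\<dots> = (\<Sum>m\<le>l. of_nat (Stirling l m) * (of_nat m * ?f m))"
    by (simp add: ac_simps)
  also have "(\<Sum>m\<le>l. of_nat (Stirling l m) * ?f (Suc m)) + \<dots>
      = (\<Sum>m\<le>l. of_nat (Stirling l m) * (x * ?f m))"
    by (simp only: step distrib_left sum.distrib)
  also have "\<dots> = x * (\<Sum>m\<le>l. of_nat (Stirling l m) * ?f m)"
    by (simp add: sum_distrib_left ac_simps)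
  also have "\<dots> = x ^ Suc l"
    using Suc.IH by simp
  finally show ?case by simp
qed

text \<open>At argument 0 the last factor is \<open>fps_exp 0 = 1\<close> whatever its base, so
  \<open>d\<close> is arbitrary; it becomes \<open>exp 1\<close> in the theorem.\<close>

lemma multi_poly_euler_gf_eq_mult_exp:
  "multi_poly_euler_gf ks x a b c
     = multi_poly_euler_gf ks 0 a b d * fps_exp (of_nat (length ks) * x * of_real (ln c))"
  by (simp add: multi_poly_euler_gf_def fps_rpow_def)

lemma multi_poly_euler_expansion:
  "multi_poly_euler ks n x a b c
     = (\<Sum>l\<le>n. of_nat (n choose l) * (of_nat (length ks) * of_real (ln c) * x) ^ l
          * multi_poly_euler ks (n - l) 0 a b d)"
proof -
  let ?y = "of_nat (length ks) * x * of_real (ln c)"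
  have "multi_poly_euler ks n x a b c
      = (\<Sum>l\<le>n. fact n * (fps_nth (multi_poly_euler_gf ks 0 a b d) (n - l) * (?y ^ l / fact l)))"
    unfolding multi_poly_euler_def multi_poly_euler_gf_eq_mult_exp[of ks x a b c d]
    \<comment> \<open>With the exponential as left factor, the index \<open>l\<close> of the Cauchy
      product counts its coefficients.\<close>
    by (subst mult.commute[of "multi_poly_euler_gf ks 0 a b d"], subst fps_mult_nth)
      (simp add: atLeast0AtMost sum_distrib_left ac_simps)
  also have "\<dots> = (\<Sum>l\<le>n. of_nat (n choose l) * (of_nat (length ks) * of_real (ln c) * x) ^ l
          * multi_poly_euler ks (n - l) 0 a b d)"
    by (intro sum.cong) (simp_all add: multi_poly_euler_def binomial_fact ac_simps)
  finally show ?thesis .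
qed

theorem theorem2p3:
  fixes r n :: nat and ks :: "int list" and a b c :: real and x :: "'a::real_normed_field"
  assumes "r \<ge> 1" and "length ks = r"
    and "a > 0" and "b > 0" and "c > 0"
  shows "(\<lambda>m. \<Sum>l=m..n. of_real ((real r * ln c) ^ l) * of_nat (Stirling l m) * of_nat (n choose l)
              * multi_poly_euler_e ks (n - l) 0 a b * falling_factorial x m)
         sums multi_poly_euler ks n x a b c"
proof -
  let ?g = "\<lambda>l m. of_real ((real r * ln c) ^ l) * of_nat (Stirling l m) * of_nat (n choose l)
              * multi_poly_euler_e ks (n - l) 0 a b * falling_factorial x m"
  have "multi_poly_euler ks n x a b c
      = (\<Sum>l\<le>n. of_nat (n choose l) * (of_real ((real r * ln c) ^ l) * x ^ l)
          * multi_poly_euler_e ks (n - l) 0 a b)"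
    using assms(2) by (simp add: multi_poly_euler_expansion[of ks n x a b c "exp 1"] power_mult_distrib)
  also have "\<dots> = (\<Sum>l\<le>n. \<Sum>m\<le>l. ?g l m)"
    unfolding power_eq_sum_Stirling_falling_factorial[of x]
    by (simp add: sum_distrib_left sum_distrib_right ac_simps)
  also have "\<dots> = (\<Sum>m\<le>n. \<Sum>l=m..n. ?g l m)"
  proof -
    \<comment> \<open>Both indices range over \<open>{..n}\<close> with m \<le> l as a side
      condition, the form that \<open>sum.swap_restrict\<close> exchanges.\<close>
    have "(\<Sum>l\<le>n. \<Sum>m\<le>l. ?g l m) = (\<Sum>l\<le>n. \<Sum>m | m \<in> {..n} \<and> m \<le> l. ?g l m)"
      by (intro sum.cong) auto
    also have "\<dots> = (\<Sum>m\<le>n. \<Sum>l | l \<in> {..n} \<and> m \<le> l. ?g l m)"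
      by (rule sum.swap_restrict) auto
    also have "\<dots> = (\<Sum>m\<le>n. \<Sum>l=m..n. ?g l m)"
      by (intro sum.cong) auto
    finally show ?thesis .
  qed
  finally have "multi_poly_euler ks n x a b c = (\<Sum>m\<le>n. \<Sum>l=m..n. ?g l m)" .
  then show ?thesis
    \<comment> \<open>For m > n the range \<open>{m..n}\<close> is empty, so those terms are
      0.\<close>
    using sums_finite[of "{..n}" "\<lambda>m. \<Sum>l=m..n. ?g l m"] by simp
qed

end
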